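(* Assume that $(PF)(x)\ge F(x)$ for all $x\in\mathbf X$, that $F$ is bounded, and that there exist $\gamma_0\in(0,1)$ and a positive integer $\bar K<\infty$ such that $$\sup_{x\in\mathbf X}k^\star_\gamma(x)<\bar K\qquad\text{for all }\gamma\in[\gamma_0,1).$$ For $\gamma\in(0,1)$ define $m_\gamma:=\inf_{(x,k)\in\mathbf X\times\mathbb N_0}V_\gamma(x,k)$. Then $$\sup_{\gamma\in(0,1)}\ \sup_{(x,k)\in\mathbf X\times\mathbb N_0}\big(V_\gamma(x,k)-m_\gamma\big)<\infty.$$ Specifically, with $\bar c:=\|F\|_\infty+\max\{|G(n)|,|G(r)|\}$, where $\|\cdot\|_\infty$ is the supremum norm, $$\sup_{\gamma\in(0,1)}\ \sup_{(x,k)\in\mathbf X\times\mathbb N_0}\big(V_\gamma(x,k)-m_\gamma\big)\le\max\left\{\frac{2\bar c}{1-\gamma_0},\ 4\bar K\bar c\right\}.$$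
   Context: Setting. $\mathbf X$ is a Borel space, $P$ is a stochastic (Markov) kernel on $\mathbf X$ given $\mathbf X$, $\nu$ is a probability measure on $\mathbf X$, $F:\mathbf X\to[0,\infty]$ is measurable, and $G(n),G(r)\in[0,\infty)$ are constants. $\mathbb N_0=\{0,1,2,\dots\}$. $P^k$ is the $k$-fold composition of $P$ ($P^0$ is the identity kernel) and $(P^kF)(x)=\int_{\mathbf X}F(y)P^k(dy\mid x)$. The MDP $\{\mathbf S,\mathbf A,Q,c\}$ (the fully observed reduction of the Restart POMDP) has state space $\mathbf S=\mathbf X\times\mathbb N_0$ (last observed state, time elapsed since last restart), action space $\mathbf A=\{n,r\}$ ($n$: no intervention, $r$: restart), transition kernel $Q(dx'\times dk'\mid(x,k),n)=\delta_x(dx')\delta_{k+1}(dk')$, $Q(dx'\times dk'\mid(x,k),r)=\nu(dx')\delta_0(dk')$, and one-step cost $c(x,k;a)=(P^kF)(x)+G(a)$. A policy $\pi=\{\pi_t\}_{t\ge0}$ is a sequence of stochastic kernels $\pi_t$ on $\mathbf A$ given $(\mathbf S\times\mathbf A)^t\times\mathbf S$ (randomized, history-dependent). $\mathsf E^\pi_{x,k}$ is the expectation for the process $\{(S_t,A_t)\}$ of states and actions under $\pi$ started at $(x,k)$. For $\gamma\in(0,1)$, $V^\pi_\gamma(x,k)=\mathsf E^\pi_{x,k}\big[\sum_{t\ge0}\gamma^t c(S_t,A_t)\big]$ and $V_\gamma(x,k)=\inf_\pi V^\pi_\gamma(x,k)$ (the $\gamma$-discounted value function). Threshold index: with $V_{0,\gamma}=\int_{\mathbf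 X}V_\gamma(z,0)\,\nu(dz)$ and $A(\gamma)=G(r)+\gamma V_{0,\gamma}$, $$k^\star_\gamma(x)=\inf\{k\in\mathbb N_0: A(\gamma)\le G(n)+\gamma V_\gamma(x,k+1)\}\in\mathbb N_0\cup\{\infty\},\qquad \inf\emptyset=\infty.$$ *)

theory Defs
  imports "HOL-Probability.Probability"
begin

text \<open>
  Throughout, a measurable space is a \<open>measure\<close> of which only the carrier and the
  \<open>\<sigma>\<close>-algebra matter.
\<close>

text \<open>A Borel space is a Borel subset of a Polish space with its Borel \<open>\<sigma>\<close>-algebra.\<close>

definition borel_space :: "'x::polish_space measure \<Rightarrow> bool" where
  "borel_space X \<longleftrightarrow> (\<exists>B \<in> sets borel. sets X = sets (restrict_space borel B))"

primrec kernel_pow :: "'x measure \<Rightarrow> ('x \<Rightarrow> 'x measure) \<Rightarrow> nat \<Rightarrow> 'x \<Rightarrow> 'x measure" where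
  "kernel_pow X P 0 x = return X x"
| "kernel_pow X P (Suc k) x = kernel_pow X P k x \<bind> P"

datatype action = NoIntervention | Restart

definition state_space :: "'x measure \<Rightarrow> ('x \<times> nat) measure" where
  "state_space X = X \<Otimes>\<^sub>M count_space UNIV"

definition action_space :: "action measure" where
  "action_space = count_space UNIV"

abbreviation sa_space :: "'x measure \<Rightarrow> (('x \<times> nat) \<times> action) measure" where
  "sa_space X \<equiv> state_space X \<Otimes>\<^sub>M action_space"

definition trans_kernel ::
  "'x measure \<Rightarrow> 'x measure \<Rightarrow> ('x \<times> nat) \<times> action \<Rightarrow> ('x \<times> nat) measure" where
  "trans_kernel X \<nu> = (\<lambda>((x, k), a). case a of
     NoIntervention \<Rightarrow> return X x \<Otimes>\<^sub>M return (count_space UNIV) (k + 1)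
   | Restart \<Rightarrow> \<nu> \<Otimes>\<^sub>M return (count_space UNIV) 0)"

definition cost :: "'x measure \<Rightarrow> ('x \<Rightarrow> 'x measure) \<Rightarrow> ('x \<Rightarrow> ennreal) \<Rightarrow> (action \<Rightarrow> real) \<Rightarrow>
    ('x \<times> nat) \<times> action \<Rightarrow> ennreal" where
  "cost X P F G = (\<lambda>((x, k), a). (\<integral>\<^sup>+y. F y \<partial>kernel_pow X P k x) + ennreal (G a))"

text \<open>
  A history up to time \<open>t\<close> is a pair of the state-action pairs at the times \<open>0, \<dots>, t - 1\<close>
  (an element of a finite product over \<open>{0..<t}\<close>) and the state at time \<open>t\<close>.
\<close>

type_synonym 'x policy =
  "nat \<Rightarrow> (nat \<Rightarrow> ('x \<times> nat) \<times> action) \<times> ('x \<times> nat) \<Rightarrow> action measure"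

definition history_space ::
  "'x measure \<Rightarrow> nat \<Rightarrow> ((nat \<Rightarrow> ('x \<times> nat) \<times> action) \<times> ('x \<times> nat)) measure" where
  "history_space X t = (\<Pi>\<^sub>M i\<in>{0..<t}. sa_space X) \<Otimes>\<^sub>M state_space X"

definition policies :: "'x measure \<Rightarrow> 'x policy set" where
  "policies X = {\<pi>. \<forall>t. \<pi> t \<in> history_space X t \<rightarrow>\<^sub>M prob_algebra action_space}"

text \<open>
  The conditional distribution of the state-action pair at time \<open>t\<close>, given the previous ones.
\<close>

definition step_kernel :: "'x measure \<Rightarrow> 'x measure \<Rightarrow> 'x policy \<Rightarrow> ('x \<times> nat) \<Rightarrow>
    nat \<Rightarrow> (nat \<Rightarrow> ('x \<times> nat) \<times> action) \<Rightarrow> (('x \<times> nat) \<times> action) measure" where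
  "step_kernel X \<nu> \<pi> s0 t \<omega> =
     (case t of 0 \<Rightarrow> return (state_space X) s0 | Suc j \<Rightarrow> trans_kernel X \<nu> (\<omega> j)) \<bind>
     (\<lambda>s. \<pi> t (\<omega>, s) \<bind> (\<lambda>a. return (sa_space X) (s, a)))"

text \<open>
  The law of the process of states and actions on infinite trajectories; this is the measure
  that the Ionescu-Tulcea theorem provides (see \<open>Ionescu_Tulcea_step_kernel\<close> below).
\<close>

definition traj_measure :: "'x measure \<Rightarrow> 'x measure \<Rightarrow> 'x policy \<Rightarrow> ('x \<times> nat) \<Rightarrow>
    (nat \<Rightarrow> ('x \<times> nat) \<times> action) measure" where
  "traj_measure X \<nu> \<pi> s0 =
     projective_family.lim UNIV
       (Ionescu_Tulcea.CI (step_kernel X \<nu> \<pi> s0) (\<lambda>_. sa_space X)) (\<lambda>_. sa_space X)"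

definition policy_value :: "'x measure \<Rightarrow> ('x \<Rightarrow> 'x measure) \<Rightarrow> 'x measure \<Rightarrow> ('x \<Rightarrow> ennreal) \<Rightarrow>
    (action \<Rightarrow> real) \<Rightarrow> real \<Rightarrow> 'x policy \<Rightarrow> 'x \<times> nat \<Rightarrow> ennreal" where
  "policy_value X P \<nu> F G \<gamma> \<pi> s =
     (\<integral>\<^sup>+\<omega>. (\<Sum>t. ennreal (\<gamma> ^ t) * cost X P F G (\<omega> t)) \<partial>traj_measure X \<nu> \<pi> s)"

definition value_fun :: "'x measure \<Rightarrow> ('x \<Rightarrow> 'x measure) \<Rightarrow> 'x measure \<Rightarrow> ('x \<Rightarrow> ennreal) \<Rightarrow>
    (action \<Rightarrow> real) \<Rightarrow> real \<Rightarrow> 'x \<times> nat \<Rightarrow> ennreal" where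
  "value_fun X P \<nu> F G \<gamma> s = (INF \<pi>\<in>policies X. policy_value X P \<nu> F G \<gamma> \<pi> s)"

definition restart_cost :: "'x measure \<Rightarrow> ('x \<Rightarrow> 'x measure) \<Rightarrow> 'x measure \<Rightarrow> ('x \<Rightarrow> ennreal) \<Rightarrow>
    (action \<Rightarrow> real) \<Rightarrow> real \<Rightarrow> ennreal" where
  "restart_cost X P \<nu> F G \<gamma> =
     ennreal (G Restart) + ennreal \<gamma> * (\<integral>\<^sup>+z. value_fun X P \<nu> F G \<gamma> (z, 0) \<partial>\<nu>)"

text \<open>In \<open>enat\<close>, the infimum of the empty set is \<open>\<infinity>\<close>.\<close>

definition threshold :: "'x measure \<Rightarrow> ('x \<Rightarrow> 'x measure) \<Rightarrow> 'x measure \<Rightarrow> ('x \<Rightarrow> ennreal) \<Rightarrow>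
    (action \<Rightarrow> real) \<Rightarrow> real \<Rightarrow> 'x \<Rightarrow> enat" where
  "threshold X P \<nu> F G \<gamma> x =
     Inf {enat k | k. restart_cost X P \<nu> F G \<gamma>
       \<le> ennreal (G NoIntervention) + ennreal \<gamma> * value_fun X P \<nu> F G \<gamma> (x, k + 1)}"

definition min_value :: "'x measure \<Rightarrow> ('x \<Rightarrow> 'x measure) \<Rightarrow> 'x measure \<Rightarrow> ('x \<Rightarrow> ennreal) \<Rightarrow>
    (action \<Rightarrow> real) \<Rightarrow> real \<Rightarrow> ennreal" where
  "min_value X P \<nu> F G \<gamma> = (INF s\<in>space X \<times> UNIV. value_fun X P \<nu> F G \<gamma> s)"

definition cost_bound :: "'x measure \<Rightarrow> ('x \<Rightarrow> ennreal) \<Rightarrow> (action \<Rightarrow> real) \<Rightarrow> ennreal" where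
  "cost_bound X F G =
     (SUP x\<in>space X. F x) + ennreal (max \<bar>G NoIntervention\<bar> \<bar>G Restart\<bar>)"

lemma measurable_trans_kernel:
  assumes \<nu>: "\<nu> \<in> space (prob_algebra X)"
  shows "trans_kernel X \<nu> \<in> sa_space X \<rightarrow>\<^sub>M prob_algebra (state_space X)"
proof -
  let ?N = "count_space (UNIV :: nat set)"
  have n: "(\<lambda>p. return X (fst (fst p)) \<Otimes>\<^sub>M return ?N (snd (fst p) + 1))
      \<in> sa_space X \<rightarrow>\<^sub>M prob_algebra (state_space X)"
    unfolding state_space_def
    by (intro measurable_pair_prob measurable_compose[OF _ measurable_return_prob_space])
      measurable
  have r: "(\<lambda>p. \<nu> \<Otimes>\<^sub>M return ?N 0) \<in> sa_space X \<rightarrow>\<^sub>M prob_algebra (state_space X)"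
    unfolding state_space_def
    by (intro measurable_pair_prob measurable_const \<nu>
        measurable_space[OF measurable_return_prob_space]) simp
  have "Measurable.pred (sa_space X) (\<lambda>p. snd p = NoIntervention)"
    unfolding action_space_def by measurable
  from measurable_If[OF n r this[unfolded pred_def]]
  have "(\<lambda>p. if snd p = NoIntervention then return X (fst (fst p)) \<Otimes>\<^sub>M return ?N (snd (fst p) + 1)
      else \<nu> \<Otimes>\<^sub>M return ?N 0) \<in> sa_space X \<rightarrow>\<^sub>M prob_algebra (state_space X)" .
  also have "(\<lambda>p. if snd p = NoIntervention then return X (fst (fst p)) \<Otimes>\<^sub>M return ?N (snd (fst p) + 1)
      else \<nu> \<Otimes>\<^sub>M return ?N 0) = trans_kernel X \<nu>"
    by (auto simp: trans_kernel_def fun_eq_iff split: action.split)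
  finally show ?thesis .
qed

lemma measurable_step_kernel:
  assumes \<nu>: "\<nu> \<in> space (prob_algebra X)" and \<pi>: "\<pi> \<in> policies X"
    and s0: "s0 \<in> space (state_space X)"
  shows "step_kernel X \<nu> \<pi> s0 t \<in> (\<Pi>\<^sub>M i\<in>{0..<t}. sa_space X) \<rightarrow>\<^sub>M prob_algebra (sa_space X)"
proof -
  let ?H = "\<Pi>\<^sub>M i\<in>{0..<t}. sa_space X"
  note measurable_trans_kernel[OF \<nu>, measurable]
  have [measurable]: "\<pi> t \<in> ?H \<Otimes>\<^sub>M state_space X \<rightarrow>\<^sub>M prob_algebra action_space"
    using \<pi> by (simp add: policies_def history_space_def)
  have [measurable]: "return (sa_space X) \<in> sa_space X \<rightarrow>\<^sub>M prob_algebra (sa_space X)"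
    by (rule measurable_return_prob_space)
  have 1: "(\<lambda>\<omega>. case t of 0 \<Rightarrow> return (state_space X) s0 | Suc j \<Rightarrow> trans_kernel X \<nu> (\<omega> j))
      \<in> ?H \<rightarrow>\<^sub>M prob_algebra (state_space X)"
  proof (cases t)
    case 0
    then show ?thesis
      using measurable_space[OF measurable_return_prob_space s0] by simp
  next
    case (Suc j)
    have "(\<lambda>\<omega>. \<omega> j) \<in> ?H \<rightarrow>\<^sub>M sa_space X"
      using Suc by (intro measurable_component_singleton) auto
    from measurable_compose[OF this measurable_trans_kernel[OF \<nu>]] Suc show ?thesis by simp
  qed
  have 2: "(\<lambda>(\<omega>, s). \<pi> t (\<omega>, s) \<bind> (\<lambda>a. return (sa_space X) (s, a)))
      \<in> ?H \<Otimes>\<^sub>M state_space X \<rightarrow>\<^sub>M prob_algebra (sa_space X)"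
    unfolding case_prod_beta
    by (rule measurable_bind_prob_space2[where N=action_space]) measurable
  show ?thesis
    unfolding step_kernel_def
    by (rule measurable_bind_prob_space2[OF 1 2])
qed

lemma Ionescu_Tulcea_step_kernel:
  assumes "\<nu> \<in> space (prob_algebra X)" "\<pi> \<in> policies X" "s0 \<in> space (state_space X)"
  shows "Ionescu_Tulcea (step_kernel X \<nu> \<pi> s0) (\<lambda>_. sa_space X)"
proof (rule Ionescu_Tulcea.intro)
  fix i \<omega>
  note K = measurable_step_kernel[OF assms, of i]
  show "step_kernel X \<nu> \<pi> s0 i
      \<in> (\<Pi>\<^sub>M i\<in>{0..<i}. sa_space X) \<rightarrow>\<^sub>M subprob_algebra (sa_space X)"
    by (rule measurable_prob_algebraD[OF K])
  assume "\<omega> \<in> space (\<Pi>\<^sub>M i\<in>{0..<i}. sa_space X)"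
  from measurable_space[OF K this] show "prob_space (step_kernel X \<nu> \<pi> s0 i \<omega>)"
    by (simp add: space_prob_algebra)
qed

end

theory Submission
  imports Defs
begin

text \<open>
  Value iteration from \<open>0\<close> increases to a bounded measurable fixed point \<open>W\<close> of the Bellman operator.
  Along any policy the discounted cost accumulated before time \<open>n\<close> plus \<open>\<gamma>\<^sup>n W(S\<^sub>n)\<close> has expectation
  at least \<open>W(s\<^sub>0)\<close>, with equality for the stationary greedy policy; hence \<open>W\<close> is the value function
  and it satisfies the Bellman equation
  \<open>V(x,k) = (P\<^sup>kF)(x) + min A (G(n) + \<gamma> V(x,k+1))\<close>, where \<open>A\<close> is the cost of a restart.
  Thus \<open>V \<le> c + A\<close> everywhere, \<open>c\<close> being the cost bound. Conversely, at the threshold index \<open>k\<close> of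
  \<open>x\<close> we have \<open>V(x,k) \<ge> A\<close>; larger indices only increase \<open>V\<close>, and each step down from \<open>k\<close> loses at
  most \<open>(1 - \<gamma>) V \<le> c\<close>. As \<open>k < K\<close>, all values lie within \<open>(K + 1) c \<le> 4 K c\<close> of each other.
  For \<open>\<gamma> < \<gamma>\<^sub>0\<close> the trivial bound \<open>V \<le> c / (1 - \<gamma>)\<close> suffices.
\<close>

section \<open>Marginals and one-step integrals of the Ionescu-Tulcea measure\<close>

text \<open>The limit measure is characterised only through its finite-dimensional marginals
  \<open>CI\<close>. On an initial segment \<open>CI\<close> is the composition \<open>C 0 n\<close>
  of the first kernels, whose recursion in \<open>n\<close> can then be unfolded.\<close>

lemma (in Ionescu_Tulcea) distr_lim_restrict:
  "distr PF.lim (PiM {0..<n} M) (\<lambda>\<omega>. restrict \<omega> {0..<n}) = C 0 n (\<lambda>_. undefined)"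
proof (rule measure_eqI)
  fix A assume "A \<in> sets (distr PF.lim (PiM {0..<n} M) (\<lambda>\<omega>. restrict \<omega> {0..<n}))"
  then have A: "A \<in> sets (PiM {0..<n} M)" by simp
  have "emeasure (distr PF.lim (PiM {0..<n} M) (\<lambda>\<omega>. restrict \<omega> {0..<n})) A
      = emeasure PF.lim (PF.emb UNIV {0..<n} A)"
    by (rule emeasure_distr_restrict) (auto simp: A)
  also have "\<dots> = emeasure (CI {0..<n}) A"
    by (rule lim) (auto simp: A)
  also have "\<dots> = emeasure (C 0 n (\<lambda>_. undefined)) A"
    using A sets.sets_into_space[OF A]
    by (subst emeasure_CI[of _ n]) (auto simp: prod_emb_id space_PiM)
  finally show "emeasure (distr PF.lim (PiM {0..<n} M) (\<lambda>\<omega>. restrict \<omega> {0..<n})) A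
      = emeasure (C 0 n (\<lambda>_. undefined)) A" .
qed (simp add: sets_C)

text \<open>Functions of finitely many initial coordinates can be integrated against
  \<open>C 0 m\<close> instead of the limit. Unfolding the last step of \<open>C 0 (Suc n)\<close>
  shows coordinate \<open>n\<close> being drawn from \<open>P n\<close>; the outer integral is then
  carried back to the limit.\<close>

lemma (in Ionescu_Tulcea) nn_integral_lim_component:
  assumes f[measurable]: "f \<in> borel_measurable (M n)"
  shows "(\<integral>\<^sup>+\<omega>. f (\<omega> n) \<partial>PF.lim) = (\<integral>\<^sup>+\<omega>. (\<integral>\<^sup>+x. f x \<partial>P n (restrict \<omega> {0..<n})) \<partial>PF.lim)"
proof -
  have lim_C: "(\<integral>\<^sup>+\<omega>. h \<omega> \<partial>C 0 m (\<lambda>_. undefined)) = (\<integral>\<^sup>+\<omega>. h (restrict \<omega> {0..<m}) \<partial>PF.lim)"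
    if "h \<in> borel_measurable (PiM {0..<m} M)" for h m
    unfolding distr_lim_restrict[symmetric] using that
    by (intro nn_integral_distr) (auto simp: measurable_cong_sets[OF PF.sets_lim refl])
  have fn: "(\<lambda>\<omega>. f (\<omega> n)) \<in> borel_measurable (PiM {0..<Suc n} M)"
    by measurable
  have Pf: "(\<lambda>\<omega>. \<integral>\<^sup>+x. f x \<partial>P n \<omega>) \<in> borel_measurable (PiM {0..<n} M)"
    by (rule measurable_compose[OF P nn_integral_measurable_subprob_algebra]) measurable
  have "(\<integral>\<^sup>+\<omega>. f (\<omega> n) \<partial>PF.lim) = (\<integral>\<^sup>+\<omega>. f (\<omega> n) \<partial>C 0 (Suc n) (\<lambda>_. undefined))"
    by (subst lim_C[OF fn]) simp
  also have "\<dots> = (\<integral>\<^sup>+\<omega>. (\<integral>\<^sup>+\<omega>'. f (\<omega>' n) \<partial>eP n \<omega>) \<partial>C 0 n (\<lambda>_. undefined))"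
    unfolding C.simps add_0
    by (rule nn_integral_bind[OF fn]) (simp add: measurable_cong_sets[OF sets_C refl])
  also have "\<dots> = (\<integral>\<^sup>+\<omega>. (\<integral>\<^sup>+x. f x \<partial>P n \<omega>) \<partial>C 0 n (\<lambda>_. undefined))"
    by (intro nn_integral_cong) (simp add: space_C nn_integral_eP)
  also have "\<dots> = (\<integral>\<^sup>+\<omega>. (\<integral>\<^sup>+x. f x \<partial>P n (restrict \<omega> {0..<n})) \<partial>PF.lim)"
    by (rule lim_C[OF Pf])
  finally show ?thesis .
qed

text \<open>Total mass survives a pushforward, so it can be read off from the restriction to the
  empty set of coordinates.\<close>

lemma (in Ionescu_Tulcea) prob_space_lim: "prob_space PF.lim"
proof (rule prob_space_distrD)
  show "(\<lambda>\<omega>. restrict \<omega> {0..<0}) \<in> PF.lim \<rightarrow>\<^sub>M PiM {0..<0} M"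
    by (auto simp: measurable_cong_sets[OF PF.sets_lim refl] intro!: measurable_restrict_subset)
  show "prob_space (distr PF.lim (PiM {0..<0} M) (\<lambda>\<omega>. restrict \<omega> {0..<0}))"
    unfolding distr_lim_restrict by (rule prob_space_C) simp
qed

section \<open>Setting, kernels and one-step costs\<close>

lemma ennreal_min_add_left: "min (a + b) (a + c) = a + min b (c :: ennreal)"
  by (cases b c rule: le_cases) (simp_all add: min_absorb1 min_absorb2 add_left_mono)

locale restart_mdp =
  fixes X :: "'x measure"
    and P :: "'x \<Rightarrow> 'x measure"
    and \<nu> :: "'x measure"
    and F :: "'x \<Rightarrow> ennreal"
    and G :: "action \<Rightarrow> real"
    and \<gamma> :: real
  assumes P: "P \<in> X \<rightarrow>\<^sub>M prob_algebra X"
    and \<nu>: "\<nu> \<in> space (prob_algebra X)"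
    and F[measurable]: "F \<in> borel_measurable X"
    and G_nonneg: "0 \<le> G a"
    and F_mono: "x \<in> space X \<Longrightarrow> F x \<le> (\<integral>\<^sup>+y. F y \<partial>P x)"
    and F_bounded: "(SUP x\<in>space X. F x) < \<infinity>"
    and \<gamma>: "0 < \<gamma>" "\<gamma> < 1"
begin

text \<open>The part of \<open>cost\<close> that is independent of the action. It factors out of the
  minimum over actions.\<close>

definition running :: "'x \<times> nat \<Rightarrow> ennreal" where
  "running s = (\<integral>\<^sup>+y. F y \<partial>kernel_pow X P (snd s) (fst s))"

text \<open>The state-action value with continuation \<open>w\<close>. Taking a pair as argument
  lets it be evaluated directly at a trajectory coordinate \<open>\<omega> n\<close>.\<close>

definition Qval :: "('x \<times> nat \<Rightarrow> ennreal) \<Rightarrow> ('x \<times> nat) \<times> action \<Rightarrow> ennreal" where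
  "Qval w p = cost X P F G p + ennreal \<gamma> * (\<integral>\<^sup>+s. w s \<partial>trans_kernel X \<nu> p)"

definition bellman :: "('x \<times> nat \<Rightarrow> ennreal) \<Rightarrow> 'x \<times> nat \<Rightarrow> ennreal" where
  "bellman w s = min (Qval w (s, Restart)) (Qval w (s, NoIntervention))"

text \<open>A countable supremum of measurable iterates is measurable, whereas for
  \<open>value_fun\<close>, an infimum over all policies, this is not evident.
  \<open>value_fun_eq_W\<close> identifies the two.\<close>

definition W :: "'x \<times> nat \<Rightarrow> ennreal" where
  "W s = (SUP n. (bellman ^^ n) (\<lambda>_. 0) s)"

text \<open>A real copy of the finite cost bound, so that quotients such as
  \<open>cb / (1 - \<gamma>)\<close> are computed in the reals.\<close>

definition cb :: real where
  "cb = enn2real (cost_bound X F G)"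

lemma cost_eq: "cost X P F G (s, a) = running s + ennreal (G a)"
  by (simp add: cost_def running_def split: prod.split)

lemma ennreal_cb: "ennreal cb = cost_bound X F G"
  using F_bounded unfolding cb_def cost_bound_def by (intro ennreal_enn2real) simp

lemma cb_nonneg: "0 \<le> cb"
  by (simp add: cb_def)

lemma kernel_pow_measurable: "kernel_pow X P k \<in> X \<rightarrow>\<^sub>M prob_algebra X"
proof (induction k)
  case 0
  have "kernel_pow X P 0 = return X" by (rule ext) simp
  then show ?case by (simp only: measurable_return_prob_space)
next
  case (Suc k)
  have "kernel_pow X P (Suc k) = (\<lambda>x. kernel_pow X P k x \<bind> P)" by (rule ext) simp
  then show ?case by (simp only: measurable_bind_prob_space[OF Suc P])
qed

lemma kernel_pow_prob:
  assumes "x \<in> space X"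
  shows "sets (kernel_pow X P k x) = sets X" "prob_space (kernel_pow X P k x)"
    "space (kernel_pow X P k x) = space X"
  using measurable_space[OF kernel_pow_measurable assms, of k]
  by (auto simp: space_prob_algebra dest: sets_eq_imp_space_eq)

lemma running_measurable[measurable]: "running \<in> borel_measurable (state_space X)"
proof -
  have "(\<lambda>x. \<integral>\<^sup>+y. F y \<partial>kernel_pow X P k x) \<in> borel_measurable X" for k
    by (rule measurable_compose[OF measurable_prob_algebraD[OF kernel_pow_measurable]
        nn_integral_measurable_subprob_algebra]) measurable
  \<comment> \<open>The second coordinate is countable, so joint measurability reduces to
    measurability in \<open>x\<close> for each fixed \<open>k\<close>.\<close>
  then have "(\<lambda>s. \<integral>\<^sup>+y. F y \<partial>kernel_pow X P (snd s) (fst s)) \<in> borel_measurable (X \<Otimes>\<^sub>M count_space UNIV)"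
    by (intro measurable_compose_countable'[where I=UNIV and g=snd
          and f="\<lambda>k s. \<integral>\<^sup>+y. F y \<partial>kernel_pow X P k (fst s)"]
        measurable_compose[OF measurable_fst]) auto
  then show ?thesis
    by (simp add: running_def[abs_def] state_space_def)
qed

lemma cost_measurable[measurable]: "cost X P F G \<in> borel_measurable (sa_space X)"
proof -
  have "cost X P F G = (\<lambda>p. running (fst p) + ennreal (G (snd p)))"
    by (auto simp: cost_eq fun_eq_iff)
  moreover have "(\<lambda>p. ennreal (G (snd p))) \<in> borel_measurable (sa_space X)"
    unfolding action_space_def
    by (rule measurable_compose[OF measurable_snd]) simp
  ultimately show ?thesis by simp
qed

text \<open>Integrating \<open>F \<le> PF\<close> against \<open>P^k\<close> gives
  \<open>P^k F \<le> P^k (PF)\<close>, and the right-hand side is \<open>P^(k+1) F\<close>.\<close>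

lemma running_Suc_ge:
  assumes "x \<in> space X"
  shows "running (x, k) \<le> running (x, Suc k)"
proof -
  have P': "P \<in> kernel_pow X P k x \<rightarrow>\<^sub>M subprob_algebra X"
    using measurable_prob_algebraD[OF P]
    by (simp only: measurable_cong_sets[OF kernel_pow_prob(1)[OF assms] refl])
  have "running (x, k) \<le> (\<integral>\<^sup>+z. (\<integral>\<^sup>+y. F y \<partial>P z) \<partial>kernel_pow X P k x)"
    unfolding running_def fst_conv snd_conv
    by (intro nn_integral_mono F_mono) (simp add: kernel_pow_prob[OF assms])
  also have "\<dots> = running (x, Suc k)"
    unfolding running_def fst_conv snd_conv kernel_pow.simps
    by (rule nn_integral_bind[OF F P', symmetric])
  finally show ?thesis .
qed

lemma running_plus_le:
  assumes "x \<in> space X"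
  shows "running (x, k) + ennreal (G a) \<le> ennreal cb"
proof -
  interpret prob_space "kernel_pow X P k x" by (rule kernel_pow_prob[OF assms])
  have "running (x, k) \<le> (\<integral>\<^sup>+y. (SUP x\<in>space X. F x) \<partial>kernel_pow X P k x)"
    unfolding running_def fst_conv snd_conv
    by (intro nn_integral_mono SUP_upper) (simp add: kernel_pow_prob[OF assms])
  then have "running (x, k) \<le> (SUP x\<in>space X. F x)"
    by (simp add: emeasure_space_1)
  moreover have "G a \<le> max \<bar>G NoIntervention\<bar> \<bar>G Restart\<bar>"
    by (cases a) auto
  ultimately show ?thesis
    unfolding ennreal_cb cost_bound_def by (intro add_mono ennreal_leI)
qed

lemma trans_kernel_prob:
  assumes "p \<in> space (sa_space X)"
  shows "sets (trans_kernel X \<nu> p) = sets (state_space X)" "prob_space (trans_kernel X \<nu> p)"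
    "space (trans_kernel X \<nu> p) = space (state_space X)"
  using measurable_space[OF measurable_trans_kernel[OF \<nu>] assms]
  by (auto simp: space_prob_algebra dest: sets_eq_imp_space_eq)

lemma in_sa_space: "(s, a) \<in> space (sa_space X) \<longleftrightarrow> s \<in> space (state_space X)"
  by (simp add: space_pair_measure action_space_def)

lemma in_state_space: "(x, k) \<in> space (state_space X) \<longleftrightarrow> x \<in> space X"
  by (simp add: space_pair_measure state_space_def)

lemma \<nu>_prob: "sets \<nu> = sets X" "prob_space \<nu>" "space \<nu> = space X"
  using \<nu> by (auto simp: space_prob_algebra dest: sets_eq_imp_space_eq)

lemma trans_kernel_NoIntervention:
  assumes [measurable]: "w \<in> borel_measurable (state_space X)" and x: "x \<in> space X"
  shows "(\<integral>\<^sup>+s. w s \<partial>trans_kernel X \<nu> ((x, k), NoIntervention)) = w (x, k + 1)"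
proof -
  interpret N: prob_space "return (count_space UNIV) (Suc k)" by (rule prob_space_return) simp
  have w: "w \<in> borel_measurable (X \<Otimes>\<^sub>M count_space UNIV)"
    using assms by (simp add: state_space_def)
  have "(\<integral>\<^sup>+s. w s \<partial>(return X x \<Otimes>\<^sub>M return (count_space UNIV) (Suc k)))
      = (\<integral>\<^sup>+y. \<integral>\<^sup>+j. w (y, j) \<partial>return (count_space UNIV) (Suc k) \<partial>return X x)"
    using w by (intro N.nn_integral_fst[symmetric])
      (subst measurable_cong_sets[OF sets_pair_measure_cong[OF sets_return sets_return] refl])
  also have "\<dots> = (\<integral>\<^sup>+y. w (y, Suc k) \<partial>return X x)"
    by (simp add: nn_integral_return)
  also have "\<dots> = w (x, Suc k)"
    using x w by (intro nn_integral_return) auto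
  finally show ?thesis by (simp add: trans_kernel_def)
qed

lemma trans_kernel_Restart:
  assumes [measurable]: "w \<in> borel_measurable (state_space X)"
  shows "(\<integral>\<^sup>+s. w s \<partial>trans_kernel X \<nu> ((x, k), Restart)) = (\<integral>\<^sup>+z. w (z, 0) \<partial>\<nu>)"
proof -
  interpret N: prob_space "return (count_space UNIV) (0::nat)" by (rule prob_space_return) simp
  have w: "w \<in> borel_measurable (X \<Otimes>\<^sub>M count_space UNIV)"
    using assms by (simp add: state_space_def)
  have "(\<integral>\<^sup>+s. w s \<partial>(\<nu> \<Otimes>\<^sub>M return (count_space UNIV) 0))
      = (\<integral>\<^sup>+y. \<integral>\<^sup>+j. w (y, j) \<partial>return (count_space UNIV) 0 \<partial>\<nu>)"
    using w by (intro N.nn_integral_fst[symmetric])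
      (subst measurable_cong_sets[OF sets_pair_measure_cong[OF \<nu>_prob(1) sets_return] refl])
  also have "\<dots> = (\<integral>\<^sup>+y. w (y, 0) \<partial>\<nu>)"
    by (simp add: nn_integral_return)
  finally show ?thesis by (simp add: trans_kernel_def)
qed

section \<open>The Bellman operator and value iteration\<close>

lemma Qval_measurable:
  assumes "w \<in> borel_measurable (state_space X)"
  shows "Qval w \<in> borel_measurable (sa_space X)"
proof -
  have [measurable]: "(\<lambda>p. \<integral>\<^sup>+s. w s \<partial>trans_kernel X \<nu> p) \<in> borel_measurable (sa_space X)"
    by (rule measurable_compose[OF measurable_prob_algebraD[OF measurable_trans_kernel[OF \<nu>]]
        nn_integral_measurable_subprob_algebra]) (rule assms)
  show ?thesis unfolding Qval_def[abs_def] by measurable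
qed

lemma Qval_action_measurable:
  assumes "w \<in> borel_measurable (state_space X)"
  shows "(\<lambda>s. Qval w (s, a)) \<in> borel_measurable (state_space X)"
  by (rule measurable_compose[OF _ Qval_measurable[OF assms]]) (simp add: action_space_def)

lemma bellman_measurable:
  "w \<in> borel_measurable (state_space X) \<Longrightarrow> bellman w \<in> borel_measurable (state_space X)"
  unfolding bellman_def[abs_def] by (intro borel_measurable_min Qval_action_measurable)

lemma iterate_measurable: "(bellman ^^ n) (\<lambda>_. 0) \<in> borel_measurable (state_space X)"
  by (induction n) (simp_all add: bellman_measurable)

lemma W_measurable[measurable]: "W \<in> borel_measurable (state_space X)"
  unfolding W_def[abs_def] by (intro borel_measurable_SUP iterate_measurable) simp

lemma bellman_mono: "w \<le> w' \<Longrightarrow> bellman w \<le> bellman w'"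
  unfolding bellman_def Qval_def le_fun_def
  by (intro allI min.mono add_left_mono mult_left_mono nn_integral_mono) auto

lemma iterate_incseq: "incseq (\<lambda>n. (bellman ^^ n) (\<lambda>_. 0))"
proof (rule incseq_SucI)
  fix n show "(bellman ^^ n) (\<lambda>_. 0) \<le> (bellman ^^ Suc n) (\<lambda>_. 0)"
  proof (induction n)
    case (Suc n) then show ?case using bellman_mono by simp
  qed (simp add: le_fun_def)
qed

text \<open>By monotone convergence the transition integrals of the iterates converge to those of
  \<open>W\<close>. The remaining operations, ending with a minimum over two actions, are
  continuous, so \<open>bellman\<close> of the iterates tends to \<open>bellman W\<close>; as the
  shifted sequence of iterates it also tends to \<open>W\<close>.\<close>

lemma bellman_W:
  assumes s: "s \<in> space (state_space X)"
  shows "bellman W s = W s"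
proof -
  let ?w = "\<lambda>n. (bellman ^^ n) (\<lambda>_. 0)"
  have "(\<lambda>n. \<integral>\<^sup>+s. ?w n s \<partial>trans_kernel X \<nu> (s, a)) \<longlonglongrightarrow> (\<integral>\<^sup>+s. W s \<partial>trans_kernel X \<nu> (s, a))" for a
  proof -
    have "(\<integral>\<^sup>+s. W s \<partial>trans_kernel X \<nu> (s, a)) = (SUP n. \<integral>\<^sup>+s. ?w n s \<partial>trans_kernel X \<nu> (s, a))"
      unfolding W_def
      by (rule nn_integral_monotone_convergence_SUP[OF iterate_incseq])
        (use iterate_measurable trans_kernel_prob(1)[of "(s, a)"] s in
          \<open>simp add: in_sa_space cong: measurable_cong_sets\<close>)
    moreover have "incseq (\<lambda>n. \<integral>\<^sup>+s. ?w n s \<partial>trans_kernel X \<nu> (s, a))"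
      using iterate_incseq by (auto simp: incseq_def le_fun_def intro!: nn_integral_mono)
    ultimately show ?thesis using LIMSEQ_SUP by metis
  qed
  then have "(\<lambda>n. bellman (?w n) s) \<longlonglongrightarrow> bellman W s"
    unfolding bellman_def Qval_def
    by (intro tendsto_min tendsto_add tendsto_const ennreal_tendsto_cmult) auto
  moreover have "(\<lambda>n. ?w n s) \<longlonglongrightarrow> W s"
    unfolding W_def using iterate_incseq by (intro LIMSEQ_SUP) (simp add: incseq_def le_fun_def del: split_paired_All)
  then have "(\<lambda>n. bellman (?w n) s) \<longlonglongrightarrow> W s"
    using LIMSEQ_Suc[of "\<lambda>n. ?w n s" "W s"] by simp
  ultimately show ?thesis by (rule LIMSEQ_unique)
qed

lemma bellman_explicit:
  assumes w: "w \<in> borel_measurable (state_space X)" and x: "x \<in> space X"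
  shows "bellman w (x, k) = running (x, k) +
    min (ennreal (G Restart) + ennreal \<gamma> * (\<integral>\<^sup>+z. w (z, 0) \<partial>\<nu>))
        (ennreal (G NoIntervention) + ennreal \<gamma> * w (x, k + 1))"
  unfolding bellman_def Qval_def cost_eq
  by (simp add: trans_kernel_NoIntervention[OF w x] trans_kernel_Restart[OF w] add.assoc
      ennreal_min_add_left)

lemma W_fixpoint:
  assumes x: "x \<in> space X"
  shows "W (x, k) = running (x, k) +
    min (ennreal (G Restart) + ennreal \<gamma> * (\<integral>\<^sup>+z. W (z, 0) \<partial>\<nu>))
        (ennreal (G NoIntervention) + ennreal \<gamma> * W (x, k + 1))"
  using bellman_W[of "(x, k)"] bellman_explicit[OF W_measurable x] x by (simp add: in_state_space)

section \<open>Monotonicity in the elapsed time and boundedness of \<open>W\<close>\<close>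

text \<open>Every iterate is already nondecreasing in \<open>k\<close>: the running cost is, the
  restart branch does not depend on \<open>k\<close>, and the other branch evaluates the previous
  iterate at the next index. That shift is why the induction generalises over
  \<open>k\<close>.\<close>

lemma W_Suc_ge:
  assumes x: "x \<in> space X"
  shows "W (x, k) \<le> W (x, Suc k)"
proof -
  have "(bellman ^^ n) (\<lambda>_. 0) (x, k) \<le> (bellman ^^ n) (\<lambda>_. 0) (x, Suc k)" for n k
  proof (induction n arbitrary: k)
    case (Suc n)
    show ?case
      using Suc[of "Suc k"] running_Suc_ge[OF x, of k]
      by (auto simp: bellman_explicit[OF iterate_measurable x]
          intro!: add_mono min.mono mult_left_mono)
  qed simp
  then show ?thesis unfolding W_def by (intro SUP_mono) auto
qed

lemma W_mono: "x \<in> space X \<Longrightarrow> i \<le> j \<Longrightarrow> W (x, i) \<le> W (x, j)"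
  by (rule lift_Suc_mono_le[of "\<lambda>k. W (x, k)"]) (auto intro: W_Suc_ge)

text \<open>The sum of the geometric series with first term \<open>cb\<close> and ratio \<gamma>
  solves the recursion C = cb + \<gamma> C; this closes the induction in
  \<open>W_le\<close>.\<close>

lemma cb_geometric: "ennreal cb + ennreal \<gamma> * ennreal (cb / (1 - \<gamma>)) = ennreal (cb / (1 - \<gamma>))"
proof -
  have "cb + \<gamma> * (cb / (1 - \<gamma>)) = cb / (1 - \<gamma>)"
    using \<gamma> by (simp add: field_simps)
  then show ?thesis
    using \<gamma> cb_nonneg by (simp flip: ennreal_mult ennreal_plus)
qed

text \<open>The minimum is at most the branch without intervention, so each iterate is bounded by
  the discounted cost of never restarting, at most \<open>cb\<close> per step.\<close>

lemma W_le:
  assumes x: "x \<in> space X"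
  shows "W (x, k) \<le> ennreal (cb / (1 - \<gamma>))"
proof -
  have "(bellman ^^ n) (\<lambda>_. 0) (x, k) \<le> ennreal (cb / (1 - \<gamma>))" for n k
  proof (induction n arbitrary: k)
    case (Suc n)
    have "(bellman ^^ Suc n) (\<lambda>_. 0) (x, k)
        \<le> (running (x, k) + ennreal (G NoIntervention)) + ennreal \<gamma> * (bellman ^^ n) (\<lambda>_. 0) (x, k + 1)"
      by (simp add: bellman_explicit[OF iterate_measurable x] add.assoc)
    also have "\<dots> \<le> ennreal cb + ennreal \<gamma> * ennreal (cb / (1 - \<gamma>))"
      by (intro add_mono running_plus_le x mult_left_mono Suc) simp
    finally show ?case by (simp only: cb_geometric)
  qed simp
  then show ?thesis unfolding W_def by (intro SUP_least)
qed

section \<open>Integration against the step kernels\<close>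

lemma sets_state_kernel:
  fixes \<omega> :: "nat \<Rightarrow> ('x \<times> nat) \<times> action"
  assumes \<omega>: "\<omega> \<in> space (\<Pi>\<^sub>M i\<in>{0..<t}. sa_space X)"
  shows "sets (case t of 0 \<Rightarrow> return (state_space X) s0 | Suc j \<Rightarrow> trans_kernel X \<nu> (\<omega> j))
    = sets (state_space X)"
proof (cases t)
  case (Suc j)
  then have "\<omega> j \<in> space (sa_space X)" using \<omega> by (auto simp: space_PiM)
  then show ?thesis using Suc trans_kernel_prob(1) by simp
qed simp

text \<open>Both binds in \<open>step_kernel\<close> are unfolded: the state is integrated outside,
  the action inside. The measurability conditions come from sections of the jointly measurable
  kernels.\<close>

lemma nn_integral_step_kernel:
  fixes \<omega> :: "nat \<Rightarrow> ('x \<times> nat) \<times> action"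
  assumes \<pi>: "\<pi> \<in> policies X" and s0: "s0 \<in> space (state_space X)"
    and \<omega>: "\<omega> \<in> space (\<Pi>\<^sub>M i\<in>{0..<t}. sa_space X)"
    and g: "g \<in> borel_measurable (sa_space X)"
  shows "(\<integral>\<^sup>+p. g p \<partial>step_kernel X \<nu> \<pi> s0 t \<omega>) =
    (\<integral>\<^sup>+s. (\<integral>\<^sup>+a. g (s, a) \<partial>\<pi> t (\<omega>, s))
       \<partial>(case t of 0 \<Rightarrow> return (state_space X) s0 | Suc j \<Rightarrow> trans_kernel X \<nu> (\<omega> j)))"
proof -
  let ?H = "\<Pi>\<^sub>M i\<in>{0..<t}. sa_space X"
  let ?\<kappa> = "case t of 0 \<Rightarrow> return (state_space X) s0 | Suc j \<Rightarrow> trans_kernel X \<nu> (\<omega> j)"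
  note sets_\<kappa> = sets_state_kernel[OF \<omega>, of s0]
  have [measurable]: "\<pi> t \<in> ?H \<Otimes>\<^sub>M state_space X \<rightarrow>\<^sub>M prob_algebra action_space"
    using \<pi> by (simp add: policies_def history_space_def)
  have ret[measurable]: "return (sa_space X) \<in> sa_space X \<rightarrow>\<^sub>M prob_algebra (sa_space X)"
    by (rule measurable_return_prob_space)
  have "(\<lambda>(\<omega>, s). \<pi> t (\<omega>, s) \<bind> (\<lambda>a. return (sa_space X) (s, a)))
      \<in> ?H \<Otimes>\<^sub>M state_space X \<rightarrow>\<^sub>M prob_algebra (sa_space X)"
    unfolding case_prod_beta
    by (rule measurable_bind_prob_space2[where N=action_space]) measurable
  from measurable_compose[OF measurable_Pair1'[OF \<omega>] this]
  have N: "(\<lambda>s. \<pi> t (\<omega>, s) \<bind> (\<lambda>a. return (sa_space X) (s, a))) \<in> ?\<kappa> \<rightarrow>\<^sub>M subprob_algebra (sa_space X)"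
    unfolding measurable_cong_sets[OF sets_\<kappa> refl] by (intro measurable_prob_algebraD) simp
  have "(\<integral>\<^sup>+p. g p \<partial>step_kernel X \<nu> \<pi> s0 t \<omega>)
      = (\<integral>\<^sup>+s. (\<integral>\<^sup>+p. g p \<partial>(\<pi> t (\<omega>, s) \<bind> (\<lambda>a. return (sa_space X) (s, a)))) \<partial>?\<kappa>)"
    unfolding step_kernel_def by (rule nn_integral_bind[OF g N])
  also have "\<dots> = (\<integral>\<^sup>+s. (\<integral>\<^sup>+a. g (s, a) \<partial>\<pi> t (\<omega>, s)) \<partial>?\<kappa>)"
  proof (rule nn_integral_cong)
    fix s assume "s \<in> space ?\<kappa>"
    then have s: "s \<in> space (state_space X)"
      using sets_eq_imp_space_eq[OF sets_\<kappa>] by simp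
    have "\<pi> t (\<omega>, s) \<in> space (prob_algebra action_space)"
      using \<omega> s by (intro measurable_space[of "\<pi> t" "?H \<Otimes>\<^sub>M state_space X"])
        (simp_all add: space_pair_measure)
    then have sets_\<pi>: "sets (\<pi> t (\<omega>, s)) = sets action_space"
      by (simp add: space_prob_algebra)
    have "(\<lambda>a. return (sa_space X) (s, a)) \<in> \<pi> t (\<omega>, s) \<rightarrow>\<^sub>M subprob_algebra (sa_space X)"
      unfolding measurable_cong_sets[OF sets_\<pi> refl]
      by (rule measurable_prob_algebraD[OF measurable_compose[OF measurable_Pair1'[OF s] ret]])
    then have "(\<integral>\<^sup>+p. g p \<partial>(\<pi> t (\<omega>, s) \<bind> (\<lambda>a. return (sa_space X) (s, a))))
        = (\<integral>\<^sup>+a. (\<integral>\<^sup>+p. g p \<partial>return (sa_space X) (s, a)) \<partial>\<pi> t (\<omega>, s))"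
      by (rule nn_integral_bind[OF g])
    also have "\<dots> = (\<integral>\<^sup>+a. g (s, a) \<partial>\<pi> t (\<omega>, s))"
      by (intro nn_integral_cong nn_integral_return) (simp_all add: g s in_sa_space)
    finally show "(\<integral>\<^sup>+p. g p \<partial>(\<pi> t (\<omega>, s) \<bind> (\<lambda>a. return (sa_space X) (s, a))))
        = (\<integral>\<^sup>+a. g (s, a) \<partial>\<pi> t (\<omega>, s))" .
  qed
  finally show ?thesis .
qed

text \<open>A function of the state alone is unaffected by the action, since the policy's kernels
  have total mass one.\<close>

lemma nn_integral_step_kernel_state:
  fixes \<omega> :: "nat \<Rightarrow> ('x \<times> nat) \<times> action"
  assumes \<pi>: "\<pi> \<in> policies X" and s0: "s0 \<in> space (state_space X)"
    and \<omega>: "\<omega> \<in> space (\<Pi>\<^sub>M i\<in>{0..<t}. sa_space X)"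
    and h: "h \<in> borel_measurable (state_space X)"
  shows "(\<integral>\<^sup>+p. h (fst p) \<partial>step_kernel X \<nu> \<pi> s0 t \<omega>) =
    (\<integral>\<^sup>+s. h s \<partial>(case t of 0 \<Rightarrow> return (state_space X) s0 | Suc j \<Rightarrow> trans_kernel X \<nu> (\<omega> j)))"
    (is "_ = integral\<^sup>N ?\<kappa> _")
proof -
  note space_\<kappa> = sets_eq_imp_space_eq[OF sets_state_kernel[OF \<omega>, of s0]]
  have "(\<lambda>p. h (fst p)) \<in> borel_measurable (sa_space X)"
    using h by measurable
  then have "(\<integral>\<^sup>+p. h (fst p) \<partial>step_kernel X \<nu> \<pi> s0 t \<omega>) = (\<integral>\<^sup>+s. (\<integral>\<^sup>+a. h s \<partial>\<pi> t (\<omega>, s)) \<partial>?\<kappa>)"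
    by (subst nn_integral_step_kernel[OF \<pi> s0 \<omega>]) simp_all
  also have "\<dots> = integral\<^sup>N ?\<kappa> h"
  proof (rule nn_integral_cong)
    fix s assume "s \<in> space ?\<kappa>"
    with \<omega> have "(\<omega>, s) \<in> space (history_space X t)"
      unfolding space_\<kappa> by (simp add: history_space_def space_pair_measure)
    moreover have "\<pi> t \<in> history_space X t \<rightarrow>\<^sub>M prob_algebra action_space"
      using \<pi> by (simp add: policies_def)
    ultimately have "\<pi> t (\<omega>, s) \<in> space (prob_algebra action_space)"
      by (rule measurable_space[rotated])
    then interpret prob_space "\<pi> t (\<omega>, s)" by (simp add: space_prob_algebra)
    show "(\<integral>\<^sup>+a. h s \<partial>\<pi> t (\<omega>, s)) = h s" by (simp add: emeasure_space_1)
  qed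
  finally show ?thesis .
qed

lemma W_le_Qval:
  assumes "p \<in> space (sa_space X)"
  shows "W (fst p) \<le> Qval W p"
proof -
  obtain s a where p: "p = (s, a)" by (cases p)
  with assms have "W s = bellman W s" by (simp add: bellman_W in_sa_space)
  also have "\<dots> \<le> Qval W (s, a)" by (cases a) (simp_all add: bellman_def)
  finally show ?thesis by (simp add: p)
qed

section \<open>Trajectories under a fixed policy and the lower bound for its value\<close>

context
  fixes \<pi> :: "'x policy" and s0 :: "'x \<times> nat"
  assumes \<pi>: "\<pi> \<in> policies X" and s0: "s0 \<in> space (state_space X)"
begin

interpretation IT: Ionescu_Tulcea "step_kernel X \<nu> \<pi> s0" "\<lambda>_. sa_space X"
  by (rule Ionescu_Tulcea_step_kernel[OF \<nu> \<pi> s0])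

abbreviation (input) "traj \<equiv> traj_measure X \<nu> \<pi> s0"

lemma sets_traj: "sets traj = sets (\<Pi>\<^sub>M i\<in>UNIV. sa_space X)"
  unfolding traj_measure_def by simp

lemma space_traj: "space traj = space (\<Pi>\<^sub>M i\<in>UNIV. sa_space X)"
  by (rule sets_eq_imp_space_eq[OF sets_traj])

lemma prob_space_traj: "prob_space traj"
  unfolding traj_measure_def by (rule IT.prob_space_lim)

lemma traj_component: "\<omega> \<in> space traj \<Longrightarrow> \<omega> t \<in> space (sa_space X)"
  unfolding space_traj by (auto simp: space_PiM)

lemma traj_restrict:
  "\<omega> \<in> space traj \<Longrightarrow> restrict \<omega> {0..<t} \<in> space (\<Pi>\<^sub>M i\<in>{0..<t}. sa_space X)"
  unfolding space_traj by (auto simp: space_PiM)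

lemma traj_component_measurable: "(\<lambda>\<omega>. \<omega> t) \<in> traj \<rightarrow>\<^sub>M sa_space X"
  unfolding measurable_cong_sets[OF sets_traj refl] by (rule measurable_component_singleton) simp

lemma nn_integral_traj_component:
  "g \<in> borel_measurable (sa_space X) \<Longrightarrow> (\<integral>\<^sup>+\<omega>. g (\<omega> t) \<partial>traj) =
    (\<integral>\<^sup>+\<omega>. (\<integral>\<^sup>+p. g p \<partial>step_kernel X \<nu> \<pi> s0 t (restrict \<omega> {0..<t})) \<partial>traj)"
  unfolding traj_measure_def by (rule IT.nn_integral_lim_component)

lemma nn_integral_traj_state:
  assumes h: "h \<in> borel_measurable (state_space X)"
  shows "(\<integral>\<^sup>+\<omega>. h (fst (\<omega> t)) \<partial>traj) = (\<integral>\<^sup>+\<omega>. (\<integral>\<^sup>+s. h s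
    \<partial>(case t of 0 \<Rightarrow> return (state_space X) s0 | Suc j \<Rightarrow> trans_kernel X \<nu> (\<omega> j))) \<partial>traj)"
proof -
  have "(\<lambda>p. h (fst p)) \<in> borel_measurable (sa_space X)"
    using h by measurable
  then have "(\<integral>\<^sup>+\<omega>. h (fst (\<omega> t)) \<partial>traj) = (\<integral>\<^sup>+\<omega>. (\<integral>\<^sup>+p. h (fst p)
      \<partial>step_kernel X \<nu> \<pi> s0 t (restrict \<omega> {0..<t})) \<partial>traj)"
    by (rule nn_integral_traj_component)
  also have "\<dots> = (\<integral>\<^sup>+\<omega>. (\<integral>\<^sup>+s. h s
    \<partial>(case t of 0 \<Rightarrow> return (state_space X) s0 | Suc j \<Rightarrow> trans_kernel X \<nu> (\<omega> j))) \<partial>traj)"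
    by (intro nn_integral_cong, subst nn_integral_step_kernel_state[OF \<pi> s0 traj_restrict h])
      (auto split: nat.split)
  finally show ?thesis .
qed

lemma nn_integral_traj_state_0:
  assumes h: "h \<in> borel_measurable (state_space X)"
  shows "(\<integral>\<^sup>+\<omega>. h (fst (\<omega> 0)) \<partial>traj) = h s0"
  using prob_space.emeasure_space_1[OF prob_space_traj]
  by (simp add: nn_integral_traj_state[OF h] nn_integral_return[OF s0 h])

text \<open>Tonelli turns the value into a series of expected stage costs, whose partial sums are
  compared with \<open>W\<close> below.\<close>

lemma policy_value_eq:
  "policy_value X P \<nu> F G \<gamma> \<pi> s0 = (\<Sum>t. ennreal (\<gamma> ^ t) * (\<integral>\<^sup>+\<omega>. cost X P F G (\<omega> t) \<partial>traj))"
proof -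
  have [measurable]: "(\<lambda>\<omega>. cost X P F G (\<omega> t)) \<in> borel_measurable traj" for t
    by (rule measurable_compose[OF traj_component_measurable cost_measurable])
  show ?thesis
    unfolding policy_value_def by (simp add: nn_integral_suminf nn_integral_cmult)
qed

text \<open>The transition kernel at \<open>\<omega> n\<close> is the conditional law of the state
  at time \<open>Suc n\<close>, so the expected continuation is the expectation of \<open>W\<close>
  one step later.\<close>

lemma nn_integral_traj_Qval_W:
  "(\<integral>\<^sup>+\<omega>. Qval W (\<omega> n) \<partial>traj)
    = (\<integral>\<^sup>+\<omega>. cost X P F G (\<omega> n) \<partial>traj) + ennreal \<gamma> * (\<integral>\<^sup>+\<omega>. W (fst (\<omega> (Suc n))) \<partial>traj)"
proof -
  have [measurable]: "(\<lambda>\<omega>. cost X P F G (\<omega> n)) \<in> borel_measurable traj"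
    by (rule measurable_compose[OF traj_component_measurable cost_measurable])
  have "(\<lambda>p. \<integral>\<^sup>+s. W s \<partial>trans_kernel X \<nu> p) \<in> borel_measurable (sa_space X)"
    by (rule measurable_compose[OF measurable_prob_algebraD[OF measurable_trans_kernel[OF \<nu>]]
        nn_integral_measurable_subprob_algebra]) measurable
  from measurable_compose[OF traj_component_measurable this]
  have [measurable]: "(\<lambda>\<omega>. \<integral>\<^sup>+s. W s \<partial>trans_kernel X \<nu> (\<omega> n)) \<in> borel_measurable traj" .
  show ?thesis
    unfolding Qval_def by (simp add: nn_integral_add nn_integral_cmult nn_integral_traj_state)
qed

text \<open>Telescoping: the remainder at time \<open>n\<close> is at most
  \<open>\<gamma> ^ n\<close> times the expectation of \<open>Qval W\<close>, which splits into the
  stage cost at time \<open>n\<close> and the remainder at time \<open>Suc n\<close>.\<close>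

lemma W_le_partial:
  "W s0 \<le> (\<Sum>t<n. ennreal (\<gamma> ^ t) * (\<integral>\<^sup>+\<omega>. cost X P F G (\<omega> t) \<partial>traj))
    + ennreal (\<gamma> ^ n) * (\<integral>\<^sup>+\<omega>. W (fst (\<omega> n)) \<partial>traj)"
proof (induction n)
  case 0 show ?case by (simp add: nn_integral_traj_state_0)
next
  case (Suc n)
  have "(\<integral>\<^sup>+\<omega>. W (fst (\<omega> n)) \<partial>traj) \<le> (\<integral>\<^sup>+\<omega>. Qval W (\<omega> n) \<partial>traj)"
    by (intro nn_integral_mono W_le_Qval traj_component)
  then have "ennreal (\<gamma> ^ n) * (\<integral>\<^sup>+\<omega>. W (fst (\<omega> n)) \<partial>traj) \<le> ennreal (\<gamma> ^ n) * (\<integral>\<^sup>+\<omega>. Qval W (\<omega> n) \<partial>traj)"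
    by (rule mult_left_mono) simp
  also have "\<dots> = ennreal (\<gamma> ^ n) * (\<integral>\<^sup>+\<omega>. cost X P F G (\<omega> n) \<partial>traj)
      + ennreal (\<gamma> ^ Suc n) * (\<integral>\<^sup>+\<omega>. W (fst (\<omega> (Suc n))) \<partial>traj)"
    using \<gamma> by (simp add: nn_integral_traj_Qval_W distrib_left ennreal_mult mult_ac)
  finally show ?case
    using order_trans[OF Suc add_left_mono] by (simp add: add.assoc)
qed

text \<open>As \<open>W\<close> is bounded, the remainder in \<open>W_le_partial\<close> is at most
  \<open>\<gamma> ^ n * ?C\<close> and vanishes in the limit.\<close>

lemma W_le_policy_value: "W s0 \<le> policy_value X P \<nu> F G \<gamma> \<pi> s0" (is "_ \<le> ?V")
proof -
  let ?C = "cb / (1 - \<gamma>)"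
  have "W s0 \<le> ?V + ennreal (\<gamma> ^ n * ?C)" for n
  proof -
    have "(\<integral>\<^sup>+\<omega>. W (fst (\<omega> n)) \<partial>traj) \<le> (\<integral>\<^sup>+\<omega>. ennreal ?C \<partial>traj)"
    proof (rule nn_integral_mono)
      fix \<omega> assume "\<omega> \<in> space traj"
      then have "\<omega> n \<in> space (sa_space X)" by (rule traj_component)
      then show "W (fst (\<omega> n)) \<le> ennreal ?C"
        by (cases "\<omega> n") (auto simp: in_sa_space in_state_space intro: W_le)
    qed
    also have "\<dots> = ennreal ?C"
      using prob_space.emeasure_space_1[OF prob_space_traj] by simp
    finally have "ennreal (\<gamma> ^ n) * (\<integral>\<^sup>+\<omega>. W (fst (\<omega> n)) \<partial>traj) \<le> ennreal (\<gamma> ^ n) * ennreal ?C"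
      by (rule mult_left_mono) simp
    also have "\<dots> = ennreal (\<gamma> ^ n * ?C)"
      using \<gamma> cb_nonneg by (intro ennreal_mult[symmetric]) auto
    finally have "ennreal (\<gamma> ^ n) * (\<integral>\<^sup>+\<omega>. W (fst (\<omega> n)) \<partial>traj) \<le> ennreal (\<gamma> ^ n * ?C)" .
    moreover have "(\<Sum>t<n. ennreal (\<gamma> ^ t) * (\<integral>\<^sup>+\<omega>. cost X P F G (\<omega> t) \<partial>traj)) \<le> ?V"
      unfolding policy_value_eq by (rule sum_le_suminf) auto
    ultimately show ?thesis
      by (intro order_trans[OF W_le_partial] add_mono)
  qed
  moreover have "(\<lambda>n. ?V + ennreal (\<gamma> ^ n * ?C)) \<longlonglongrightarrow> ?V + ennreal (0 * ?C)"
    using \<gamma> by (intro tendsto_intros LIMSEQ_realpow_zero) auto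
  ultimately show ?thesis
    using LIMSEQ_le_const[of "\<lambda>n. ?V + ennreal (\<gamma> ^ n * ?C)" ?V "W s0"] by simp
qed

end

section \<open>The greedy policy and the identification of the value function\<close>

text \<open>Ties go to \<open>Restart\<close>. With two actions, a comparison of two measurable
  functions gives a measurable selector.\<close>

definition greedy :: "'x \<times> nat \<Rightarrow> action" where
  "greedy s = (if Qval W (s, Restart) \<le> Qval W (s, NoIntervention) then Restart else NoIntervention)"

definition greedy_policy :: "'x policy" where
  "greedy_policy t = (\<lambda>(\<omega>, s). return action_space (greedy s))"

lemma greedy_measurable[measurable]: "greedy \<in> state_space X \<rightarrow>\<^sub>M action_space"
proof -
  have [measurable]: "(\<lambda>s. Qval W (s, a)) \<in> borel_measurable (state_space X)" for a
    by (rule Qval_action_measurable[OF W_measurable])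
  show ?thesis unfolding greedy_def[abs_def] action_space_def by measurable
qed

lemma greedy_policy_in: "greedy_policy \<in> policies X"
  unfolding policies_def greedy_policy_def history_space_def case_prod_beta
  by (auto intro!: measurable_compose[OF _ measurable_return_prob_space]
      measurable_compose[OF measurable_snd greedy_measurable])

text \<open>The telescoping of \<open>W_le_partial\<close> becomes an equality, because greedy
  actions attain the Bellman minimum.\<close>

lemma policy_value_greedy_le:
  assumes s0: "s0 \<in> space (state_space X)"
  shows "policy_value X P \<nu> F G \<gamma> greedy_policy s0 \<le> W s0"
proof -
  note \<pi> = greedy_policy_in
  let ?M = "traj_measure X \<nu> greedy_policy s0"
  have Qval_greedy: "Qval W (s, greedy s) = W s" if "s \<in> space (state_space X)" for s
    using bellman_W[OF that] by (auto simp: bellman_def greedy_def min_def)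
  \<comment> \<open>\<open>Qval W p\<close> and \<open>W (fst p)\<close> may differ at non-greedy
    actions. They agree in expectation because the action is drawn from the point mass at
    \<open>greedy s\<close>.\<close>
  have step: "(\<integral>\<^sup>+\<omega>. Qval W (\<omega> n) \<partial>?M) = (\<integral>\<^sup>+\<omega>. W (fst (\<omega> n)) \<partial>?M)" for n
  proof -
    have "(\<integral>\<^sup>+p. Qval W p \<partial>step_kernel X \<nu> greedy_policy s0 n \<omega>)
        = (\<integral>\<^sup>+p. W (fst p) \<partial>step_kernel X \<nu> greedy_policy s0 n \<omega>)"
      if \<omega>: "\<omega> \<in> space (\<Pi>\<^sub>M i\<in>{0..<n}. sa_space X)" for \<omega>
    proof -
      let ?\<kappa> = "case n of 0 \<Rightarrow> return (state_space X) s0 | Suc j \<Rightarrow> trans_kernel X \<nu> (\<omega> j)"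
      note space_\<kappa> = sets_eq_imp_space_eq[OF sets_state_kernel[OF \<omega>, of s0]]
      have "(\<integral>\<^sup>+p. Qval W p \<partial>step_kernel X \<nu> greedy_policy s0 n \<omega>)
          = (\<integral>\<^sup>+s. (\<integral>\<^sup>+a. Qval W (s, a) \<partial>return action_space (greedy s)) \<partial>?\<kappa>)"
        by (subst nn_integral_step_kernel[OF \<pi> s0 \<omega> Qval_measurable[OF W_measurable]])
          (simp add: greedy_policy_def)
      also have "\<dots> = (\<integral>\<^sup>+s. W s \<partial>?\<kappa>)"
        by (intro nn_integral_cong) (simp add: space_\<kappa> nn_integral_return action_space_def Qval_greedy)
      also have "\<dots> = (\<integral>\<^sup>+p. W (fst p) \<partial>step_kernel X \<nu> greedy_policy s0 n \<omega>)"
        by (rule nn_integral_step_kernel_state[OF \<pi> s0 \<omega> W_measurable, symmetric])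
      finally show ?thesis .
    qed
    moreover have "(\<lambda>p. W (fst p)) \<in> borel_measurable (sa_space X)" by measurable
    ultimately show ?thesis
      using Qval_measurable[OF W_measurable]
      by (simp add: nn_integral_traj_component[OF \<pi> s0, of "Qval W"]
          nn_integral_traj_component[OF \<pi> s0, of "\<lambda>p. W (fst p)"] traj_restrict[OF \<pi> s0]
          cong: nn_integral_cong)
  qed
  have partial: "(\<Sum>t<n. ennreal (\<gamma> ^ t) * (\<integral>\<^sup>+\<omega>. cost X P F G (\<omega> t) \<partial>?M))
    + ennreal (\<gamma> ^ n) * (\<integral>\<^sup>+\<omega>. W (fst (\<omega> n)) \<partial>?M) = W s0" for n
  proof (induction n)
    case 0 show ?case by (simp add: nn_integral_traj_state_0[OF \<pi> s0])
  next
    case (Suc n)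
    have "ennreal (\<gamma> ^ n) * (\<integral>\<^sup>+\<omega>. W (fst (\<omega> n)) \<partial>?M)
      = ennreal (\<gamma> ^ n) * (\<integral>\<^sup>+\<omega>. cost X P F G (\<omega> n) \<partial>?M)
      + ennreal (\<gamma> ^ Suc n) * (\<integral>\<^sup>+\<omega>. W (fst (\<omega> (Suc n))) \<partial>?M)"
      using \<gamma> by (simp add: step[of n, symmetric] nn_integral_traj_Qval_W[OF \<pi> s0] distrib_left
          ennreal_mult mult_ac)
    then show ?case using Suc by (simp add: add.assoc)
  qed
  \<comment> \<open>Dropping the nonnegative remainder bounds every partial sum, hence the
    series.\<close>
  have "(\<Sum>t<n. ennreal (\<gamma> ^ t) * (\<integral>\<^sup>+\<omega>. cost X P F G (\<omega> t) \<partial>?M)) \<le> W s0" for n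
    by (subst partial[of n, symmetric]) (intro add_increasing2 order_refl zero_le)
  then show ?thesis
    unfolding policy_value_eq[OF \<pi> s0] by (intro suminf_le_const) auto
qed

lemma value_fun_eq_W:
  assumes "s \<in> space (state_space X)"
  shows "value_fun X P \<nu> F G \<gamma> s = W s"
  unfolding value_fun_def
proof (rule antisym)
  show "(INF \<pi>\<in>policies X. policy_value X P \<nu> F G \<gamma> \<pi> s) \<le> W s"
    by (rule INF_lower2[of greedy_policy]) (simp_all add: greedy_policy_in policy_value_greedy_le assms)
  show "W s \<le> (INF \<pi>\<in>policies X. policy_value X P \<nu> F G \<gamma> \<pi> s)"
    by (intro INF_greatest W_le_policy_value assms)
qed

section \<open>Comparison of \<open>W\<close> with the cost of a restart\<close>

lemma restart_cost_eq:
  "restart_cost X P \<nu> F G \<gamma> = ennreal (G Restart) + ennreal \<gamma> * (\<integral>\<^sup>+z. W (z, 0) \<partial>\<nu>)"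
proof -
  have "(\<integral>\<^sup>+z. value_fun X P \<nu> F G \<gamma> (z, 0) \<partial>\<nu>) = (\<integral>\<^sup>+z. W (z, 0) \<partial>\<nu>)"
    by (rule nn_integral_cong, rule value_fun_eq_W) (simp add: in_state_space \<nu>_prob)
  then show ?thesis by (simp only: restart_cost_def)
qed

lemma W_eq_min:
  assumes x: "x \<in> space X"
  shows "W (x, k) = running (x, k) + min (restart_cost X P \<nu> F G \<gamma>)
    (ennreal (G NoIntervention) + ennreal \<gamma> * W (x, k + 1))"
  unfolding restart_cost_eq by (rule W_fixpoint[OF x])

text \<open>Restarting at once is one of the two branches, and the running cost is at most
  \<open>cb\<close> because \<open>G\<close> is nonnegative.\<close>

lemma W_le_restart_cost:
  assumes x: "x \<in> space X"
  shows "W (x, k) \<le> restart_cost X P \<nu> F G \<gamma> + ennreal cb"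
proof -
  have "running (x, k) \<le> running (x, k) + ennreal (G Restart)" by simp
  also have "\<dots> \<le> ennreal cb" by (rule running_plus_le[OF x])
  finally show ?thesis
    unfolding W_eq_min[OF x, of k] by (subst add.commute) (intro add_mono min.cobounded1)
qed

text \<open>Multiplying \<open>W_le\<close> by \<open>1 - \<gamma>\<close> cancels the denominator:
  discounting once loses at most \<open>cb\<close>, uniformly in \<gamma>. The additive form avoids
  truncated subtraction in \<open>ennreal\<close>.\<close>

lemma W_le_discounted:
  assumes x: "x \<in> space X"
  shows "W (x, k) \<le> ennreal \<gamma> * W (x, k) + ennreal cb"
proof -
  have "W (x, k) = ennreal \<gamma> * W (x, k) + ennreal (1 - \<gamma>) * W (x, k)"
    using \<gamma> by (simp flip: distrib_right ennreal_plus)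
  also have "\<dots> \<le> ennreal \<gamma> * W (x, k) + ennreal (1 - \<gamma>) * ennreal (cb / (1 - \<gamma>))"
    by (intro add_left_mono mult_left_mono W_le x) simp
  also have "ennreal (1 - \<gamma>) * ennreal (cb / (1 - \<gamma>)) = ennreal cb"
    using \<gamma> cb_nonneg by (simp flip: ennreal_mult)
  finally show ?thesis .
qed

text \<open>Restarting is optimal at some \<open>k < K\<close>, which gives
  \<open>?A \<le> W (x, k)\<close>. Monotonicity covers \<open>j \<ge> k\<close>; a smaller
  \<open>j\<close> is reached in at most \<open>K\<close> downward steps, each losing at most
  \<open>cb\<close>.\<close>

lemma restart_cost_le_W:
  assumes x: "x \<in> space X" and thr: "threshold X P \<nu> F G \<gamma> x < enat K"
  shows "restart_cost X P \<nu> F G \<gamma> \<le> W (x, j) + of_nat K * ennreal cb"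
proof -
  let ?A = "restart_cost X P \<nu> F G \<gamma>"
  \<comment> \<open>An infimum strictly below \<open>enat K\<close> provides a member of the
    defining set below \<open>K\<close>.\<close>
  obtain k where k: "k < K"
    and A: "?A \<le> ennreal (G NoIntervention) + ennreal \<gamma> * W (x, k + 1)"
    using thr x unfolding threshold_def Inf_less_iff by (auto simp: value_fun_eq_W in_state_space)
  have base: "?A \<le> W (x, k)"
  proof -
    have "?A = min ?A (ennreal (G NoIntervention) + ennreal \<gamma> * W (x, k + 1))"
      using A by (simp add: min_absorb1)
    also have "\<dots> \<le> W (x, k)" unfolding W_eq_min[OF x, of k] by simp
    finally show ?thesis .
  qed
  \<comment> \<open>Subtraction on \<open>nat\<close> truncates: once \<open>i \<ge> k\<close> the
    index stays at 0 and the claim only weakens as \<open>i\<close> grows.\<close>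
  have desc: "?A \<le> W (x, k - i) + of_nat i * ennreal cb" for i
  proof (induction i)
    case (Suc i)
    show ?case
    proof (cases "i < k")
      case True
      then have k': "k - i = (k - Suc i) + 1" by simp
      \<comment> \<open>The two cases say which branch attains the Bellman minimum at index
        \<open>k - Suc i\<close>: a restart gives the bound outright, while waiting leaves the
        discounted value of the next index.\<close>
      consider "?A \<le> W (x, k - Suc i)" | "ennreal \<gamma> * W (x, k - i) \<le> W (x, k - Suc i)"
      proof (cases "?A \<le> ennreal (G NoIntervention) + ennreal \<gamma> * W (x, k - i)")
        case True
        then have "?A \<le> W (x, k - Suc i)"
          unfolding W_eq_min[OF x, of "k - Suc i"] k'[symmetric] by (simp add: min_absorb1)
        then show ?thesis by (rule that)
      next
        case False
        then have "ennreal \<gamma> * W (x, k - i) \<le> W (x, k - Suc i)"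
          unfolding W_eq_min[OF x, of "k - Suc i"] k'[symmetric]
          by (simp add: min_absorb2 add_increasing)
        then show ?thesis by (rule that)
      qed
      then show ?thesis
      proof cases
        case 1 then show ?thesis by (rule order_trans) simp
      next
        case 2
        have "W (x, k - i) \<le> W (x, k - Suc i) + ennreal cb"
          by (rule order_trans[OF W_le_discounted[OF x] add_right_mono[OF 2]])
        then have "?A \<le> (W (x, k - Suc i) + ennreal cb) + of_nat i * ennreal cb"
          using Suc.IH by (meson add_right_mono order_trans)
        then show ?thesis by (simp add: algebra_simps)
      qed
    next
      case False
      then have "k - Suc i = k - i" by simp
      then have "?A \<le> W (x, k - Suc i) + of_nat i * ennreal cb" using Suc.IH by simp
      also have "\<dots> \<le> W (x, k - Suc i) + of_nat (Suc i) * ennreal cb"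
        by (intro add_left_mono mult_right_mono) auto
      finally show ?thesis .
    qed
  qed (use base in simp)
  show ?thesis
  proof (cases "k \<le> j")
    case True
    from order_trans[OF base W_mono[OF x True]] show ?thesis by (rule order_trans) simp
  next
    case False
    have "?A \<le> W (x, j) + of_nat (k - j) * ennreal cb"
      using desc[of "k - j"] False by simp
    also have "\<dots> \<le> W (x, j) + of_nat K * ennreal cb"
      using k by (intro add_left_mono mult_right_mono) auto
    finally show ?thesis .
  qed
qed

section \<open>Oscillation of the value function for a fixed discount factor\<close>

lemma min_value_eq: "min_value X P \<nu> F G \<gamma> = (INF s\<in>space X \<times> UNIV. W s)"
  unfolding min_value_def by (intro INF_cong refl value_fun_eq_W) (auto simp: in_state_space)

lemma relative_value_le_trivial:
  assumes "x \<in> space X"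
  shows "value_fun X P \<nu> F G \<gamma> (x, k) - min_value X P \<nu> F G \<gamma> \<le> ennreal (cb / (1 - \<gamma>))"
  using W_le[OF assms, of k] assms
  by (auto simp: value_fun_eq_W in_state_space intro: order_trans[OF diff_le_self_ennreal])

text \<open>The restart cost is the common reference: one value exceeds it by at most
  \<open>cb\<close>, and any other falls short of it by at most \<open>K\<close> times
  \<open>cb\<close>.\<close>

lemma relative_value_le:
  assumes x: "x \<in> space X"
    and thr: "\<And>y. y \<in> space X \<Longrightarrow> threshold X P \<nu> F G \<gamma> y < enat K"
  shows "value_fun X P \<nu> F G \<gamma> (x, k) - min_value X P \<nu> F G \<gamma> \<le> of_nat (Suc K) * ennreal cb"
proof -
  have "W (x, k) \<le> of_nat (Suc K) * ennreal cb + W s" if s: "s \<in> space X \<times> UNIV" for s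
  proof -
    obtain y j where y: "s = (y, j)" "y \<in> space X" using s by auto
    have "W (x, k) \<le> (W (y, j) + of_nat K * ennreal cb) + ennreal cb"
      by (rule order_trans[OF W_le_restart_cost[OF x]
            add_right_mono[OF restart_cost_le_W[OF y(2) thr[OF y(2)]]]])
    then show ?thesis by (simp add: y algebra_simps)
  qed
  \<comment> \<open>Subtracting the constant on the left allows passing to the infimum over
    \<open>s\<close>. Finiteness of \<open>W\<close> excludes the degenerate case top minus
    top.\<close>
  then have "W (x, k) - of_nat (Suc K) * ennreal cb \<le> (INF s\<in>space X \<times> UNIV. W s)"
    using x W_le[OF x, of k] by (intro INF_greatest) (auto simp: ennreal_minus_le_iff top_unique)
  then show ?thesis
    using x W_le[OF x, of k]
    by (auto simp: value_fun_eq_W in_state_space min_value_eq ennreal_minus_le_iff add.commute top_unique)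
qed

end

section \<open>The bound uniform in the discount factor\<close>

theorem theorem4:
  fixes X :: "'x::polish_space measure"
    and P :: "'x \<Rightarrow> 'x measure"
    and \<nu> :: "'x measure"
    and F :: "'x \<Rightarrow> ennreal"
    and G :: "action \<Rightarrow> real"
    and \<gamma>0 :: real
    and K :: nat
  assumes "borel_space X"
    and "P \<in> X \<rightarrow>\<^sub>M prob_algebra X"
    and "\<nu> \<in> space (prob_algebra X)"
    and "F \<in> borel_measurable X"
    and "\<And>a. 0 \<le> G a"
    and "\<And>x. x \<in> space X \<Longrightarrow> (\<integral>\<^sup>+y. F y \<partial>P x) \<ge> F x"
    and "\<exists>B::real. \<forall>x\<in>space X. F x \<le> ennreal B"
    and "0 < \<gamma>0" and "\<gamma>0 < 1"
    and "0 < K"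
    and "\<And>\<gamma>. \<gamma> \<in> {\<gamma>0..<1} \<Longrightarrow> (SUP x\<in>space X. threshold X P \<nu> F G \<gamma> x) < enat K"
  shows "(SUP \<gamma>\<in>{0<..<1}. SUP s\<in>space X \<times> UNIV.
            value_fun X P \<nu> F G \<gamma> s - min_value X P \<nu> F G \<gamma>) < \<infinity>
       \<and> (SUP \<gamma>\<in>{0<..<1}. SUP s\<in>space X \<times> UNIV.
            value_fun X P \<nu> F G \<gamma> s - min_value X P \<nu> F G \<gamma>)
          \<le> max (2 * cost_bound X F G / ennreal (1 - \<gamma>0)) (4 * of_nat K * cost_bound X F G)"
  (is "?S < \<infinity> \<and> ?S \<le> ?R")
proof -
  let ?c = "cost_bound X F G"
  obtain B :: real where "\<forall>x\<in>space X. F x \<le> ennreal B" using assms(7) by blast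
  then have "(SUP x\<in>space X. F x) \<le> ennreal B" by (intro SUP_least) auto
  then have F_fin: "(SUP x\<in>space X. F x) < \<infinity>" 
    by (rule le_less_trans) simp
  then have c_fin: "?c < \<infinity>" by (simp add: cost_bound_def)
  have bound: "value_fun X P \<nu> F G \<gamma> (x, k) - min_value X P \<nu> F G \<gamma> \<le> ?R"
    if \<gamma>: "0 < \<gamma>" "\<gamma> < 1" and x: "x \<in> space X" for \<gamma> x k
  proof -
    interpret restart_mdp X P \<nu> F G \<gamma>
      using assms(2-6) F_fin \<gamma> by unfold_locales auto
    show ?thesis
    proof (cases "\<gamma>0 \<le> \<gamma>")
      case True
      have "threshold X P \<nu> F G \<gamma> y < enat K" if "y \<in> space X" for y
        using assms(11)[of \<gamma>] True \<gamma> SUP_upper[OF that] by (auto intro: le_less_trans)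
      from relative_value_le[OF x this]
      have "value_fun X P \<nu> F G \<gamma> (x, k) - min_value X P \<nu> F G \<gamma> \<le> of_nat (Suc K) * ?c"
        by (simp add: ennreal_cb)
      \<comment> \<open>\<open>K + 1 \<le> 4 * K\<close> holds because \<open>K\<close> is at least
        1.\<close>
      also have "\<dots> \<le> of_nat (4 * K) * ?c"
        using \<open>0 < K\<close> by (intro mult_right_mono) (simp_all del: of_nat_Suc of_nat_mult)
      also have "\<dots> \<le> ?R" by simp
      finally show ?thesis .
    next
      case False
      have "value_fun X P \<nu> F G \<gamma> (x, k) - min_value X P \<nu> F G \<gamma> \<le> ennreal (cb / (1 - \<gamma>))"
        by (rule relative_value_le_trivial[OF x])
      \<comment> \<open>Here \<open>1 - \<gamma>\<close> exceeds \<open>1 - \<gamma>0\<close>, and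
        the factor 2 is slack.\<close>
      also have "\<dots> \<le> ennreal (2 * cb / (1 - \<gamma>0))"
        using False \<gamma> assms(9) cb_nonneg by (intro ennreal_leI frac_le) auto
      also have "\<dots> = 2 * ?c / ennreal (1 - \<gamma>0)"
        using assms(9) cb_nonneg by (simp add: divide_ennreal[symmetric] ennreal_mult ennreal_cb)
      also have "\<dots> \<le> ?R" by simp
      finally show ?thesis .
    qed
  qed
  have le: "?S \<le> ?R"
    by (intro SUP_least) (use bound in auto)
  \<comment> \<open>In \<open>ennreal\<close> the bound by \<open>?R\<close> yields finiteness only
    once \<open>?R\<close> itself is known to be finite; this rests on \<open>?c\<close> being
    finite and \<open>1 - \<gamma>0\<close> positive.\<close>
  have "2 * ?c / ennreal (1 - \<gamma>0) < \<infinity>" "4 * of_nat K * ?c < \<infinity>"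
    using c_fin assms(9)
    by (auto simp: ennreal_mult_less_top ennreal_divide_eq_top_iff less_top[symmetric]
        ennreal_mult_eq_top_iff ennreal_of_nat_eq_real_of_nat)
  then have "?R < \<infinity>" by simp
  with le show ?thesis using le_less_trans by blast
qed

end
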